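(* Let $f(x)=a_nx^n+\dots+a_0$ be a polynomial of degree $n\ge1$ with integer coefficients ($a_n\ne0$) that is expansive, and let $\alpha$ be any root of $f$. Then \[ \frac{1}{|\alpha|-1}\le\begin{cases}2^{n-2}(|a_0|+|a_n|) & \text{if }\alpha\in\mathbb{R},\\ 2^{\binom{n-1}{2}}(|a_0|+|a_n|)^{n-1}+1 & \text{if }\alpha\in\mathbb{C}\setminus\mathbb{R}.\end{cases}\]
   Context: A polynomial is expansive if all of its complex roots $\alpha$ satisfy $|\alpha|>1$. *)

theory Defs
  imports Complex_Main "HOL-Computational_Algebra.Polynomial"
begin

definition expansive :: "complex poly \<Rightarrow> bool" where
  "expansive p \<longleftrightarrow> (\<forall>z. poly p z = 0 \<longrightarrow> 1 < cmod z)"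

end

theory Submission
  imports
    Defs
    "HOL-Computational_Algebra.Fundamental_Theorem_Algebra"
    "Jordan_Normal_Form.Determinant"
    "Subresultants.Coeff_Int"
begin

text \<open>
  A real root \<open>\<alpha>\<close> is compared with \<open>f(\<plusminus>1)\<close>, a nonzero integer whose absolute value is
  \<open>|a\<^sub>n| (|\<alpha>| - 1)\<close> times a product of factors at most \<open>1 + |\<alpha>\<^sub>i|\<close> over the other roots.

  For a nonreal root, \<open>f(\<plusminus>1)\<close> is replaced by \<open>a\<^sub>n\<^sup>n\<^sup>-\<^sup>1 \<Prod>\<^sub>i\<^sub><\<^sub>j (1 - \<alpha>\<^sub>i \<alpha>\<^sub>j)\<close>, which contains the factor
  \<open>1 - |\<alpha>|\<^sup>2\<close> coming from the pair \<open>\<alpha>, cnj \<alpha>\<close>. It is an integer because, up to sign, it is the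
  determinant of the matrix with entries \<open>a\<^sub>i\<^sub>-\<^sub>j - a\<^sub>2\<^sub>n\<^sub>-\<^sub>2\<^sub>-\<^sub>i\<^sub>-\<^sub>j\<close> for \<open>0 \<le> i, j < n - 1\<close>, which describes
  \<open>u \<mapsto> u f - u* f*\<close> on polynomials \<open>u\<close> of degree at most \<open>n - 2\<close>, where \<open>*\<close> reverses the
  coefficients. The other factors are bounded by
  \<open>\<Prod>\<^sub>i\<^sub><\<^sub>j (1 + r\<^sub>i r\<^sub>j) \<le> 2\<^bsup>(n-1 choose 2)\<^esup> (1 + \<Prod> r\<^sub>i)\<^sup>n\<^sup>-\<^sup>1\<close> for \<open>r\<^sub>i \<ge> 1\<close>.
\<close>

section \<open>Pair products and the Jury-type matrix\<close>

fun pair_prod :: "('a \<Rightarrow> 'a \<Rightarrow> 'b::comm_monoid_mult) \<Rightarrow> 'a list \<Rightarrow> 'b" where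
  "pair_prod g [] = 1"
| "pair_prod g (x # xs) = (\<Prod>y\<leftarrow>xs. g x y) * pair_prod g xs"

text \<open>For \<open>p\<close> of degree at most m + 1, column \<open>j\<close> holds the lower
  coefficients of x^j p - x^(m-1-j) p*, where p* is the reversal in degree m + 1. This polynomial is
  antipalindromic in degree 2m with middle coefficient 0, so its lower half determines it. The ring
  is arbitrary so that an integer determinant can be computed from complex roots.\<close>

definition jury_mat :: "nat \<Rightarrow> 'a::comm_ring_1 poly \<Rightarrow> 'a mat" where
  "jury_mat m p = mat m m (\<lambda>(i, j).
     coeff_int p (int i - int j) - coeff_int p (2 * int m - int i - int j))"

lemma jury_mat_carrier [simp]: "jury_mat m p \<in> carrier_mat m m"
  by (simp add: jury_mat_def)

section \<open>The determinant in terms of the roots\<close>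

lemma coeff_int_linear_mult:
  fixes a :: "'a::comm_ring_1"
  shows
  "coeff_int ([:-a, 1:] * q) z = coeff_int q (z - 1) - a * coeff_int q z"
proof -
  have "[:-a, 1:] * q = pCons 0 q - Polynomial.smult a q" by simp
  thus ?thesis by (simp only: coeff_int_minus coeff_int_pCons_0 coeff_int_smult)
qed

text \<open>Summation by parts: the bracket is the coefficient of x^i in (x - a)(1 - a x) times the
  series with coefficients \<open>E\<close>. By \<open>rec\<close> this symmetric operator
  annihilates \<open>\<phi>\<close>, so only boundary terms at \<open>m\<close> survive.\<close>

lemma sum_weighted_second_difference:
  fixes a :: "'a::field" and E :: "int \<Rightarrow> 'a" and \<phi> :: "nat \<Rightarrow> 'a"
  assumes rec: "\<And>i. Suc i < N \<Longrightarrow> (1 + a^2) * \<phi> (Suc i) = a * \<phi> i + a * \<phi> (Suc (Suc i))"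
    and E: "E (-1) = 0" "E (-2) = 0" and m: "m < N"
  shows "(\<Sum>i\<le>m. \<phi> i * (-a * E (int i) + (1 + a^2) * E (int i - 1) - a * E (int i - 2)))
    = a * (\<phi> (Suc m) * E (int m - 1) - \<phi> m * E (int m))"
  using m
proof (induction m)
  case 0
  thus ?case using E by simp
next
  case (Suc m)
  have "(\<Sum>i\<le>Suc m. \<phi> i * (-a * E (int i) + (1 + a^2) * E (int i - 1) - a * E (int i - 2)))
    = a * (\<phi> (Suc m) * E (int m - 1) - \<phi> m * E (int m)) +
      \<phi> (Suc m) * (-a * E (int (Suc m)) + (1 + a^2) * E (int m) - a * E (int m - 1))"
    using Suc by (simp add: algebra_simps)
  also have "\<dots> = ((1 + a^2) * \<phi> (Suc m) - a * \<phi> m) * E (int m) - a * \<phi> (Suc m) * E (int (Suc m))"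
    by (simp add: algebra_simps)
  also have "(1 + a^2) * \<phi> (Suc m) - a * \<phi> m = a * \<phi> (Suc (Suc m))"
    using rec[of m] Suc.prems by simp
  finally show ?case by (simp add: algebra_simps)
qed

text \<open>Both sides are the value at \<open>a\<close> of the reversal of \<open>p\<close> in
  degree \<open>d\<close>.\<close>

lemma sum_reflected_coeffs:
  fixes a :: "'a::field"
  assumes a: "a \<noteq> 0" and p: "degree p \<le> d"
  shows "(\<Sum>i\<le>d. a ^ i * coeff p (d - i)) = a ^ d * poly p (inverse a)"
proof -
  have "(\<Sum>i\<le>d. a ^ i * coeff p (d - i)) = (\<Sum>i\<le>d. a ^ (d - i) * coeff p i)"
    by (subst sum.nat_diff_reindex[symmetric, of _ "Suc d", unfolded lessThan_Suc_atMost])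
       (intro sum.cong, auto)
  also have "\<dots> = (\<Sum>i\<le>d. a ^ d * (coeff p i * inverse a ^ i))"
    using a by (intro sum.cong) (auto simp: power_diff field_simps)
  also have "\<dots> = a ^ d * (\<Sum>i\<le>d. coeff p i * inverse a ^ i)"
    by (simp add: sum_distrib_left)
  also have "(\<Sum>i\<le>d. coeff p i * inverse a ^ i) = poly p (inverse a)"
    unfolding poly_altdef using p
    by (intro sum.mono_neutral_right) (auto simp: coeff_eq_0)
  finally show ?thesis .
qed

text \<open>The sum is the value at \<open>a\<close> of the antipalindromic polynomial x^k p - p*,
  written through its lower half. As p(a) = 0, only -p*(a) remains.\<close>

lemma sum_root_weighted_coeffs:
  fixes a :: "'a::field"
  assumes a: "a \<noteq> 0" and p: "degree p \<le> Suc (Suc k)" and root: "poly p a = 0"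
  shows "(\<Sum>i\<le>k. (a ^ i - a ^ (2 * Suc k - i)) * (coeff_int p (int i - int k)
           - coeff_int p (2 * int (Suc k) - int i - int k)))
    = - (a ^ Suc (Suc k) * poly p (inverse a))"
proof -
  define w where "w i = coeff p (Suc (Suc k) - i)" for i
  have idx: "coeff_int p (2 * int (Suc k) - int i - int k) = w i" if "i \<le> k" for i
  proof -
    have "2 * int (Suc k) - int i - int k = int (Suc (Suc k) - i)" using that by simp
    thus ?thesis by (simp only: coeff_int w_def)
  qed
  have diag: "coeff_int p (int i - int k) = (if i = k then coeff p 0 else 0)" if "i \<le> k" for i
    using that by (auto simp: coeff_int_def)
  have "(\<Sum>i\<le>k. (a ^ i - a ^ (2 * Suc k - i)) * (coeff_int p (int i - int k)
           - coeff_int p (2 * int (Suc k) - int i - int k)))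
    = (\<Sum>i\<le>k. (if i = k then (a ^ i - a ^ (2 * Suc k - i)) * coeff p 0 else 0)
        - a ^ i * w i + a ^ (2 * Suc k - i) * w i)"
    by (intro sum.cong refl, simp only: atMost_iff idx diag) (simp add: algebra_simps)
  also have "\<dots> = (a ^ k - a ^ (k + 2)) * coeff p 0 - (\<Sum>i\<le>k. a ^ i * w i)
      + (\<Sum>i\<le>k. a ^ (2 * Suc k - i) * w i)"
    by (simp add: sum.distrib sum_subtractf)
  also have "(\<Sum>i\<le>k. a ^ i * w i)
      = a ^ Suc (Suc k) * poly p (inverse a) - a ^ Suc k * coeff p 1 - a ^ Suc (Suc k) * coeff p 0"
    using sum_reflected_coeffs[OF a p] by (simp add: w_def algebra_simps)
  also have "(\<Sum>i\<le>k. a ^ (2 * Suc k - i) * w i) = a ^ k * (\<Sum>i\<le>k. a ^ (Suc (Suc k) - i) * w i)"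
    by (auto simp: sum_distrib_left power_add[symmetric] mult_2 intro!: sum.cong)
  \<comment> \<open>Extended to i = k + 2 the sum is p(a) = 0, so it equals minus the two added
    terms.\<close>
  also have "(\<Sum>i\<le>k. a ^ (Suc (Suc k) - i) * w i) = - coeff p 0 - a * coeff p 1"
  proof -
    have "(\<Sum>i\<le>Suc (Suc k). a ^ (Suc (Suc k) - i) * w i) = (\<Sum>i\<le>Suc (Suc k). coeff p i * a ^ i)"
      unfolding w_def
      by (subst sum.nat_diff_reindex[symmetric, of _ "Suc (Suc (Suc k))", unfolded lessThan_Suc_atMost])
         (intro sum.cong, auto simp: mult.commute)
    also have "\<dots> = poly p a"
      unfolding poly_altdef using p
      by (intro sum.mono_neutral_right) (auto simp: coeff_eq_0)
    finally show ?thesis using root by (simp add: w_def algebra_simps eq_neg_iff_add_eq_0)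
  qed
  finally show ?thesis by (simp add: algebra_simps)
qed

text \<open>
  For \<open>f = (x - a) q\<close> and \<open>u = (1 - a x) v\<close> one has \<open>u f - u* f* = (x - a) (1 - a x) (v q - v* q*)\<close>.
  So the matrix of \<open>f\<close> becomes block triangular once the monomials \<open>x\<^sup>j\<close>, \<open>j < k\<close>, are replaced by
  \<open>(1 - a x) x\<^sup>j\<close> (matrix \<open>U\<close>) and the last coordinate by the evaluation at \<open>a\<close> (matrix \<open>V\<close>); \<open>T\<close> is
  the multiplication by \<open>(x - a) (1 - a x)\<close>. The weights \<open>\<phi>\<close> express the value at \<open>a\<close> of an
  antipalindromic polynomial through the lower half of its coefficients.
\<close>

lemma det_jury_mat_linear_mult:
  fixes a :: "'a::field"
  assumes a: "a \<noteq> 0" "a^2 \<noteq> 1" and q: "degree q \<le> Suc k"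
  shows "det (jury_mat (Suc k) ([:-a, 1:] * q))
    = (-1) ^ Suc k * (a ^ Suc k * poly q (inverse a)) * det (jury_mat k q)"
proof -
  define N where "N = Suc k"
  define p where "p = [:-a, 1:] * q"
  define P where "P = coeff_int p"
  define Q where "Q = coeff_int q"
  define \<phi> where "\<phi> i = a ^ i - a ^ (2 * N - i)" for i
  define J where "J = jury_mat N p"
  define U where "U = mat N N (\<lambda>(i, j). if i = j then 1 else if i = Suc j then -a else 0)"
  define V where "V = mat N N (\<lambda>(i, j). if i < k then (if i = j then 1 else 0) else \<phi> j)"
  define T where "T = mat k k (\<lambda>(i, j). if i = j then -a else if i = Suc j then 1 + a^2
    else if i = Suc (Suc j) then -a else 0)"
  \<comment> \<open>The columns of \<open>jury_mat k q\<close>, continued to all integer row indices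
    so that shifts need no case distinction.\<close>
  define E where "E j z = Q (z - int j) - Q (2 * int k - z - int j)" for j :: nat and z
  define K where "K = J * U"
  define c where "c = - (a ^ Suc N * poly p (inverse a))"

  have [simp]: "J \<in> carrier_mat N N" "U \<in> carrier_mat N N" "V \<in> carrier_mat N N"
    "T \<in> carrier_mat k k" "K \<in> carrier_mat N N"
    by (auto simp: J_def U_def V_def T_def K_def intro!: mult_carrier_mat[of _ N N])
  have P: "P z = Q (z - 1) - a * Q z" for z
    unfolding P_def Q_def p_def by (rule coeff_int_linear_mult)
  have J: "J $$ (i, j) = P (int i - int j) - P (2 * int N - int i - int j)"
    if "i < N" "j < N" for i j
    using that by (simp add: J_def jury_mat_def P_def)
  have E_neg: "E j (-1) = 0" "E j (-2) = 0" if "j < k" for j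
    using that q by (auto simp: E_def Q_def coeff_int_eq_0)
  have E_mid: "E j (int k) = 0" for j by (simp add: E_def)

  have K_sum: "K $$ (i, j) = J $$ (i, j) - (if Suc j < N then a * J $$ (i, Suc j) else 0)"
    if ij: "i < N" "j < N" for i j
  proof -
    have "K $$ (i, j) = (\<Sum>l<N. J $$ (i, l) * U $$ (l, j))"
      using ij by (simp add: K_def J_def U_def jury_mat_def scalar_prod_def atLeast0LessThan)
    also have "\<dots> = (\<Sum>l<N. (if l = j then J $$ (i, j) else 0)
        - (if l = Suc j then a * J $$ (i, Suc j) else 0))"
      using ij by (intro sum.cong) (auto simp: U_def)
    also have "\<dots> = J $$ (i, j) - (if Suc j < N then a * J $$ (i, Suc j) else 0)"
      using ij by (simp add: sum_subtractf)
    finally show ?thesis .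
  qed
  have K_E: "K $$ (i, j) = -a * E j (int i) + (1 + a^2) * E j (int i - 1) - a * E j (int i - 2)"
    if "i < N" "j < k" for i j
  proof -
    have "K $$ (i, j) = J $$ (i, j) - a * J $$ (i, Suc j)"
      using that by (simp add: K_sum N_def)
    thus ?thesis using that
      by (simp add: J P E_def N_def algebra_simps power2_eq_square)
  qed
  have K_last: "K $$ (i, k) = P (int i - int k) - P (2 * int N - int i - int k)" if "i < N" for i
    using that by (simp add: K_sum J N_def)

  have VK_top: "(V * K) $$ (i, j) = K $$ (i, j)" if "i < k" "j < N" for i j
  proof -
    have "(V * K) $$ (i, j) = (\<Sum>l<N. V $$ (i, l) * K $$ (l, j))"
      using that by (simp add: V_def K_def J_def U_def jury_mat_def scalar_prod_def
        atLeast0LessThan N_def del: sum.lessThan_Suc)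
    also have "\<dots> = (\<Sum>l<N. if l = i then K $$ (i, j) else 0)"
      using that by (intro sum.cong) (auto simp: V_def N_def)
    finally show ?thesis using that by (simp add: N_def)
  qed
  have VK_bot: "(V * K) $$ (k, j) = (\<Sum>l\<le>k. \<phi> l * K $$ (l, j))" if "j < N" for j
  proof -
    have "(V * K) $$ (k, j) = (\<Sum>l<N. V $$ (k, l) * K $$ (l, j))"
      using that by (simp add: V_def K_def J_def U_def jury_mat_def scalar_prod_def
        atLeast0LessThan N_def del: sum.lessThan_Suc)
    also have "\<dots> = (\<Sum>l<N. \<phi> l * K $$ (l, j))"
      using that by (intro sum.cong) (auto simp: V_def N_def)
    finally show ?thesis by (simp add: N_def lessThan_Suc_atMost)
  qed
  have VK_0: "(V * K) $$ (k, j) = 0" if j: "j < k" for j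
  proof -
    have rec: "(1 + a^2) * \<phi> (Suc i) = a * \<phi> i + a * \<phi> (Suc (Suc i))" if i: "Suc i < Suc N" for i
    proof -
      have e: "2 * N - i = Suc (Suc (2 * N - Suc (Suc i)))" "2 * N - Suc i = Suc (2 * N - Suc (Suc i))"
        using i by (auto simp: N_def)
      show ?thesis unfolding \<phi>_def e by (simp add: algebra_simps power2_eq_square)
    qed
    have "(V * K) $$ (k, j) = (\<Sum>l\<le>k. \<phi> l * (-a * E j (int l) + (1 + a^2) * E j (int l - 1)
        - a * E j (int l - 2)))"
      using j by (subst VK_bot) (auto simp: N_def K_E intro!: sum.cong)
    also have "\<dots> = a * (\<phi> (Suc k) * E j (int k - 1) - \<phi> k * E j (int k))"
      using j by (intro sum_weighted_second_difference[where N = N] rec E_neg) (auto simp: N_def)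
    \<comment> \<open>Both boundary terms vanish: the two powers in \<open>\<phi> N\<close>
      coincide, and \<open>E j k\<close> is a middle coefficient.\<close>
    also have "\<dots> = 0" by (simp add: E_mid \<phi>_def N_def)
    finally show ?thesis .
  qed
  have VK_c: "(V * K) $$ (k, k) = c"
  proof -
    have deg: "degree p \<le> Suc (Suc k)"
      unfolding p_def by (rule order.trans[OF degree_mult_le]) (use q in auto)
    have root: "poly p a = 0" by (simp add: p_def)
    have "(V * K) $$ (k, k) = (\<Sum>i\<le>k. (a ^ i - a ^ (2 * Suc k - i)) *
        (coeff_int p (int i - int k) - coeff_int p (2 * int (Suc k) - int i - int k)))"
      using VK_bot[of k] by (simp add: N_def K_last P_def \<phi>_def)
    also have "\<dots> = c"
      unfolding c_def N_def by (rule sum_root_weighted_coeffs[OF a(1) deg root])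
    finally show ?thesis .
  qed
  have TJ: "(T * jury_mat k q) $$ (i, j) = K $$ (i, j)" if ij: "i < k" "j < k" for i j
  proof -
    have Jq: "jury_mat k q $$ (l, j) = E j (int l)" if "l < k" for l
      using that ij by (simp add: jury_mat_def E_def Q_def)
    have "(T * jury_mat k q) $$ (i, j) = (\<Sum>l<k. T $$ (i, l) * jury_mat k q $$ (l, j))"
      using ij by (simp add: T_def jury_mat_def scalar_prod_def atLeast0LessThan)
    also have "\<dots> = (\<Sum>l<k. (if l = i then -a * E j (int l) else 0)
        + (if i = Suc l then (1 + a^2) * E j (int l) else 0)
        + (if i = Suc (Suc l) then -a * E j (int l) else 0))"
      using ij by (intro sum.cong) (auto simp: T_def Jq)
    also have "\<dots> = -a * E j (int i) + (\<Sum>l<k. if i = Suc l then (1 + a^2) * E j (int l) else 0)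
        + (\<Sum>l<k. if i = Suc (Suc l) then -a * E j (int l) else 0)"
      using ij by (simp add: sum.distrib)
    also have "(\<Sum>l<k. if i = Suc l then (1 + a^2) * E j (int l) else 0) = (1 + a^2) * E j (int i - 1)"
      using ij E_neg[of j] by (cases i) (auto simp: sum.delta)
    also have "(\<Sum>l<k. if i = Suc (Suc l) then -a * E j (int l) else 0) = -a * E j (int i - 2)"
    proof (cases i)
      case (Suc i')
      thus ?thesis using ij E_neg[of j] by (cases i') (auto simp: sum.delta)
    qed (use ij E_neg[of j] in simp)
    finally show ?thesis using ij by (simp add: K_E N_def)
  qed

  have "V * K = four_block_mat (T * jury_mat k q) (mat k 1 (\<lambda>(i, j). K $$ (i, k)))
      (0\<^sub>m 1 k) (mat 1 1 (\<lambda>_. c))"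
  proof (rule eq_matI)
    fix i j
    assume "i < dim_row (four_block_mat (T * jury_mat k q) (mat k 1 (\<lambda>(i, j). K $$ (i, k)))
      (0\<^sub>m 1 k) (mat 1 1 (\<lambda>_. c)))"
      and "j < dim_col (four_block_mat (T * jury_mat k q) (mat k 1 (\<lambda>(i, j). K $$ (i, k)))
      (0\<^sub>m 1 k) (mat 1 1 (\<lambda>_. c)))"
    hence "i < N" "j < N" by (auto simp: T_def jury_mat_def N_def)
    moreover have "dim_row (T * jury_mat k q) = k" "dim_col (T * jury_mat k q) = k"
      by (auto simp: T_def jury_mat_def)
    ultimately show "(V * K) $$ (i, j) = four_block_mat (T * jury_mat k q)
      (mat k 1 (\<lambda>(i, j). K $$ (i, k))) (0\<^sub>m 1 k) (mat 1 1 (\<lambda>_. c)) $$ (i, j)"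
      by (cases "i < k"; cases "j < k")
        (auto simp: N_def less_Suc_eq TJ VK_top VK_0 VK_c simp del: index_mult_mat)
  qed (auto simp: T_def V_def K_def U_def jury_mat_def N_def)
  hence "det (V * K) = det (T * jury_mat k q) * det (mat 1 1 (\<lambda>_. c))"
    by (simp add: det_four_block_mat_lower_left_zero[of _ k _ 1] mult_carrier_mat[of _ k k])
  hence "det V * (det J * det U) = det T * det (jury_mat k q) * c"
    by (simp add: K_def det_mult[of _ N] det_mult[of _ k] mult_carrier_mat[of _ N N] det_single)
  moreover have "det U = 1"
    by (subst det_lower_triangular[of N])
       (auto simp: U_def prod_list_diag_prod intro!: prod.neutral)
  moreover have "det T = (-a) ^ k"
    by (subst det_lower_triangular[of k]) (auto simp: T_def prod_list_diag_prod)
  moreover have "det V = a ^ k - a ^ (k + 2)"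
    by (subst det_lower_triangular[of N])
       (auto simp: V_def prod_list_diag_prod N_def \<phi>_def)
  ultimately have "a ^ k * (1 - a^2) * det J = (-a) ^ k * det (jury_mat k q) * c"
    by (simp add: algebra_simps power2_eq_square)
  \<comment> \<open>Since p(1/a) = (1/a - a) q(1/a), the factor 1 - a^2 from \<open>det V\<close>
    also occurs on the right; the assumptions on \<open>a\<close> allow its cancellation together
    with a^k.\<close>
  also have "c = - (1 - a^2) * (a ^ Suc k * poly q (inverse a))"
    using a by (simp add: c_def p_def N_def field_simps power2_eq_square)
  also have "(-a) ^ k * det (jury_mat k q) * (- (1 - a^2) * (a ^ Suc k * poly q (inverse a)))
    = (a ^ k * (1 - a^2)) * ((-1) ^ Suc k * (a ^ Suc k * poly q (inverse a)) * det (jury_mat k q))"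
    by (subst power_minus) (simp add: algebra_simps)
  finally show ?thesis
    using a unfolding J_def p_def N_def by (subst (asm) mult_cancel_left) auto
qed

lemma pow_mult_prod_inverse_minus:
  fixes a :: "'a::field"
  assumes "a \<noteq> 0"
  shows "a ^ length bs * (\<Prod>b\<leftarrow>bs. inverse a - b) = (\<Prod>b\<leftarrow>bs. 1 - a * b)"
  using assms by (induction bs) (auto simp: field_simps)

text \<open>Splitting off the first root \<open>a\<close> contributes the factors 1 - a b for all
  later roots \<open>b\<close>, one factor \<open>c\<close>, and a sign whose exponents add up to
  the binomial coefficient. For a single root the matrix is empty.\<close>

lemma det_jury_mat_roots:
  fixes c :: "'a::field"
  assumes "rs \<noteq> []" and "\<And>r. r \<in> set rs \<Longrightarrow> r \<noteq> 0 \<and> r^2 \<noteq> 1"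
  shows "det (jury_mat (length rs - 1) (Polynomial.smult c (\<Prod>r\<leftarrow>rs. [:-r, 1:])))
    = (-1) ^ (length rs choose 2) * c ^ (length rs - 1) * pair_prod (\<lambda>x y. 1 - x * y) rs"
  using assms
proof (induction rs rule: list_nonempty_induct)
  case (single r)
  show ?case by (simp add: numeral_2_eq_2)
next
  case (cons a bs)
  define q where "q = Polynomial.smult c (\<Prod>r\<leftarrow>bs. [:-r, 1:])"
  obtain k where k: "length bs = Suc k"
    using cons.hyps by (cases bs) auto
  have "degree q \<le> Suc k"
    unfolding q_def using degree_linear_factors[of uminus bs] k by simp
  moreover have "Polynomial.smult c (\<Prod>r\<leftarrow>a # bs. [:-r, 1:]) = [:-a, 1:] * q"
    unfolding q_def by (simp only: list.map prod_list.Cons mult_smult_right)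
  ultimately have "det (jury_mat (Suc k) (Polynomial.smult c (\<Prod>r\<leftarrow>a # bs. [:-r, 1:])))
    = (-1) ^ Suc k * (a ^ Suc k * poly q (inverse a)) * det (jury_mat k q)"
    using cons.prems det_jury_mat_linear_mult[of a q k] by simp
  also have "a ^ Suc k * poly q (inverse a) = c * (\<Prod>b\<leftarrow>bs. 1 - a * b)"
    using pow_mult_prod_inverse_minus[of a bs] cons.prems k
    by (simp add: q_def poly_prod_list o_def algebra_simps)
  also have "det (jury_mat k q) = (-1) ^ (Suc k choose 2) * c ^ k * pair_prod (\<lambda>x y. 1 - x * y) bs"
    using cons k by (simp add: q_def)
  finally show ?case
    using k by (simp add: numeral_2_eq_2 power_add algebra_simps)
qed

section \<open>Inequalities for products over lists and pairs\<close>

lemma prod_list_nonneg_mono: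
  fixes f g :: "'a \<Rightarrow> real"
  assumes "\<And>x. x \<in> set xs \<Longrightarrow> 0 \<le> f x \<and> f x \<le> g x"
  shows "0 \<le> (\<Prod>x\<leftarrow>xs. f x) \<and> (\<Prod>x\<leftarrow>xs. f x) \<le> (\<Prod>x\<leftarrow>xs. g x)"
  using assms by (induction xs) (auto intro!: mult_mono order.trans[of 0 "f _" "g _"])

lemma pair_prod_nonneg_mono:
  fixes g h :: "'a \<Rightarrow> 'a \<Rightarrow> real"
  assumes "\<And>x y. 0 \<le> g x y \<and> g x y \<le> h x y"
  shows "0 \<le> pair_prod g xs \<and> pair_prod g xs \<le> pair_prod h xs"
proof (induction xs)
  case (Cons x xs)
  have "0 \<le> (\<Prod>y\<leftarrow>xs. g x y) \<and> (\<Prod>y\<leftarrow>xs. g x y) \<le> (\<Prod>y\<leftarrow>xs. h x y)"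
    by (rule prod_list_nonneg_mono) (rule assms)
  thus ?case using Cons by (auto intro!: mult_mono)
qed simp

lemma prod_list_ge_one:
  fixes xs :: "real list"
  assumes "\<And>x. x \<in> set xs \<Longrightarrow> 1 \<le> x"
  shows "1 \<le> prod_list xs"
  using prod_list_nonneg_mono[of xs "\<lambda>_. 1" id] assms by (simp add: map_replicate_const)

text \<open>Induction with (1 + x)(1 + P) \<le> 2 (1 + x P), which is (x - 1)(P - 1) \<ge> 0. The
  factor 2 on the left avoids the exponent length - 1 and gives equality for the empty list.\<close>

lemma prod_list_one_plus_le:
  fixes xs :: "real list"
  assumes "\<And>x. x \<in> set xs \<Longrightarrow> 1 \<le> x"
  shows "2 * (\<Prod>x\<leftarrow>xs. 1 + x) \<le> 2 ^ length xs * (1 + prod_list xs)"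
  using assms
proof (induction xs)
  case (Cons x xs)
  have "1 \<le> x" "1 \<le> prod_list xs" using Cons.prems by (auto intro: prod_list_ge_one)
  hence "0 \<le> 1 + x" "0 \<le> (x - 1) * (prod_list xs - 1)" by simp_all
  from this(2) have xy: "(1 + x) * (1 + prod_list xs) \<le> 2 * (1 + x * prod_list xs)" by (simp add: algebra_simps)
  have "2 * (\<Prod>x\<leftarrow>x # xs. 1 + x) = (1 + x) * (2 * (\<Prod>x\<leftarrow>xs. 1 + x))" by simp
  also have "\<dots> \<le> (1 + x) * (2 ^ length xs * (1 + prod_list xs))"
    using Cons.IH Cons.prems \<open>0 \<le> 1 + x\<close> by (intro mult_left_mono) simp_all
  also have "\<dots> = 2 ^ length xs * ((1 + x) * (1 + prod_list xs))" by simp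
  also have "\<dots> \<le> 2 ^ length xs * (2 * (1 + x * prod_list xs))"
    using xy by (intro mult_left_mono) auto
  finally show ?case by (simp add: algebra_simps)
qed simp

lemma prod_list_map_mult:
  fixes f g :: "'a \<Rightarrow> 'b::comm_monoid_mult"
  shows "(\<Prod>x\<leftarrow>xs. f x * g x) = (\<Prod>x\<leftarrow>xs. f x) * (\<Prod>x\<leftarrow>xs. g x)"
  by (induction xs) (auto simp: ac_simps)

text \<open>Replacing two entries \<open>x, y \<ge> 1\<close> by \<open>x * y, 1\<close> can only increase the left-hand side.\<close>

lemma pair_prod_one_plus_le:
  fixes xs :: "real list"
  assumes "xs \<noteq> []" and "\<And>x. x \<in> set xs \<Longrightarrow> 1 \<le> x"
  shows "pair_prod (\<lambda>x y. 1 + x * y) xs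
    \<le> 2 ^ ((length xs - 1) choose 2) * (1 + prod_list xs) ^ (length xs - 1)"
  using assms
proof (induction xs rule: length_induct)
  case (1 xs)
  let ?pp = "pair_prod (\<lambda>x y. 1 + x * y :: real)"
  consider x where "xs = [x]" | x y zs where "xs = x # y # zs"
    using 1 by (metis neq_Nil_conv)
  thus ?case
  proof cases
    case 2
    define m where "m = length zs"
    have ge1: "1 \<le> x" "1 \<le> y" "\<And>z. z \<in> set zs \<Longrightarrow> 1 \<le> z"
      using 1(3) 2 by auto
    have xy: "1 \<le> x * y" using mult_mono[of 1 x 1 y] ge1 by simp
    have P: "1 \<le> prod_list (x * y # zs)"
      using xy ge1 by (intro prod_list_ge_one) auto
    \<comment> \<open>The difference of the two products is z (x - 1)(y - 1).\<close>
    have smooth: "0 \<le> (1 + x * z) * (1 + y * z) \<and>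
        (1 + x * z) * (1 + y * z) \<le> (1 + z) * (1 + x * y * z)" if "z \<in> set zs" for z
    proof -
      have z: "1 \<le> z" using ge1 that by auto
      have "0 \<le> z * ((x - 1) * (y - 1))" using z ge1 by (intro mult_nonneg_nonneg) auto
      thus ?thesis using z ge1 by (auto simp: algebra_simps)
    qed
    have pp: "0 \<le> ?pp ws" if "\<And>w. w \<in> set ws \<Longrightarrow> 1 \<le> w" for ws
      using that
    proof (induction ws)
      case (Cons w ws)
      have "0 \<le> 1 + w * v" if "v \<in> set ws" for v
        using Cons.prems[of w] Cons.prems[of v] that by simp
      thus ?case using Cons by (auto intro!: mult_nonneg_nonneg prod_list_nonneg)
    qed simp
    have "?pp xs = (1 + x * y) * ((\<Prod>z\<leftarrow>zs. (1 + x * z) * (1 + y * z)) * ?pp zs)"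
      unfolding 2 by (simp add: prod_list_map_mult ac_simps)
    also have "\<dots> \<le> (1 + x * y) * ((\<Prod>z\<leftarrow>zs. (1 + z) * (1 + x * y * z)) * ?pp zs)"
      using prod_list_nonneg_mono[of zs, OF smooth] pp[of zs] ge1 xy
      by (intro mult_left_mono mult_right_mono) auto
    \<comment> \<open>This is the pair product of 1, x y and \<open>zs\<close>. The pairs containing
      the entry 1 are split off, leaving a shorter list for the induction hypothesis.\<close>
    also have "\<dots> = (\<Prod>z\<leftarrow>x * y # zs. 1 + z) * ?pp (x * y # zs)"
      by (simp add: prod_list_map_mult ac_simps)
    also have "\<dots> \<le> (2 ^ m * (1 + prod_list xs)) * (2 ^ (m choose 2) * (1 + prod_list xs) ^ m)"
    proof (rule mult_mono)
      show "(\<Prod>z\<leftarrow>x * y # zs. 1 + z) \<le> 2 ^ m * (1 + prod_list xs)"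
        using prod_list_one_plus_le[of "x * y # zs"] xy ge1 by (auto simp: 2 m_def mult.assoc)
      show "?pp (x * y # zs) \<le> 2 ^ (m choose 2) * (1 + prod_list xs) ^ m"
        using 1(1)[rule_format, of "x * y # zs"] xy ge1 by (auto simp: 2 m_def mult.assoc)
      show "0 \<le> 2 ^ m * (1 + prod_list xs)" using P by (simp add: 2 mult.assoc)
      show "0 \<le> ?pp (x * y # zs)"
        using xy ge1 by (intro pp) auto
    qed
    finally show ?thesis
      by (simp add: 2 m_def numeral_2_eq_2 power_add ac_simps)
  qed simp
qed

section \<open>Norms of products and lists of roots\<close>

lemma norm_prod_list:
  fixes f :: "'a \<Rightarrow> 'b::{real_normed_div_algebra, comm_ring_1}"
  shows "norm (\<Prod>x\<leftarrow>xs. f x) = (\<Prod>x\<leftarrow>xs. norm (f x))"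
  by (induction xs) (auto simp: norm_mult)

lemma norm_pair_prod:
  fixes g :: "'a \<Rightarrow> 'a \<Rightarrow> 'b::{real_normed_field}"
  shows "norm (pair_prod g xs) = pair_prod (\<lambda>x y. norm (g x y)) xs"
  by (induction xs) (auto simp: norm_mult norm_prod_list)

lemma pair_prod_map: "pair_prod g (map f xs) = pair_prod (\<lambda>x y. g (f x) (f y)) xs"
  by (induction xs) (auto simp: o_def)

text \<open>Allows the root under study, or a conjugate pair, to be placed at the head of the list
  of roots.\<close>

lemma complex_poly_roots_extend:
  fixes p :: "complex poly"
  assumes "mset xs \<subseteq># proots p"
  obtains rs where "p = Polynomial.smult (lead_coeff p) (\<Prod>r\<leftarrow>xs @ rs. [:-r, 1:])"
proof -
  obtain rs where "mset rs = proots p - mset xs" using ex_mset by blast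
  hence "mset (xs @ rs) = proots p" using assms by simp
  hence "(\<Prod>r\<in>#proots p. [:-r, 1:]) = (\<Prod>r\<leftarrow>xs @ rs. [:-r, 1:])"
    by (metis mset_map prod_mset_prod_list)
  thus thesis using that[of rs] complex_poly_decompose_multiset[of p] by simp
qed

section \<open>Root bounds for expansive integer polynomials\<close>

lemma poly_map_poly_of_int:
  "poly (map_poly of_int p) (of_int x) = (of_int (poly p x) :: 'a::{comm_ring_1, ring_char_0})"
  by (induction p) (auto simp: map_poly_pCons)

lemma norm_of_int_ge_one:
  assumes "of_int k \<noteq> (0::complex)"
  shows "1 \<le> cmod (of_int k)"
proof -
  have "1 \<le> \<bar>k\<bar>" using assms by auto
  hence "1 \<le> real_of_int \<bar>k\<bar>" by linarith
  thus ?thesis by simp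
qed

text \<open>The list \<open>rs\<close> contains all complex roots with multiplicity in a freely
  chosen order; the bounds concern its head.\<close>

locale expansive_int_poly =
  fixes f :: "int poly" and rs :: "complex list"
  assumes factors: "map_poly of_int f =
      Polynomial.smult (of_int (lead_coeff f)) (\<Prod>r\<leftarrow>rs. [:-r, 1:])"
    and nonzero: "f \<noteq> 0"
    and expansive: "expansive (map_poly of_int f)"
begin

abbreviation "F \<equiv> map_poly complex_of_int f"

lemma length_rs: "length rs = degree f"
proof -
  have "degree F = length rs"
    unfolding factors using nonzero degree_linear_factors[of uminus rs] by simp
  thus ?thesis by (simp add: degree_map_poly)
qed

lemma norm_poly: "cmod (poly F x) = \<bar>lead_coeff f\<bar> * (\<Prod>r\<leftarrow>rs. cmod (x - r))"
  unfolding factors by (simp add: poly_prod_list o_def norm_mult norm_prod_list)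

lemma root_norm: "r \<in> set rs \<Longrightarrow> 1 < cmod r"
  using expansive unfolding expansive_def factors
  by (auto simp: poly_prod_list prod_list_zero_iff)

text \<open>Vieta's formula, which later turns |a_n| (1 + \<Prod> |r|) into |a_0| + |a_n|.\<close>

lemma norm_coeff_0: "real_of_int \<bar>coeff f 0\<bar> = \<bar>lead_coeff f\<bar> * (\<Prod>r\<leftarrow>rs. cmod r)"
proof -
  have "poly F 0 = of_int (coeff f 0)" by (simp add: poly_0_coeff_0 coeff_map_poly)
  thus ?thesis using norm_poly[of 0] by simp
qed

lemma real_root_bound:
  assumes rs: "rs = \<alpha> # zs" and real: "\<alpha> \<in> \<real>"
  shows "1 / (cmod \<alpha> - 1) \<le> 2 powi (int (degree f) - 2) * (\<bar>coeff f 0\<bar> + \<bar>lead_coeff f\<bar>)"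
proof -
  obtain t where t: "\<alpha> = of_real t" using real by (auto elim: Reals_cases)
  have t1: "1 < \<bar>t\<bar>" using root_norm[of \<alpha>] by (simp add: rs t)
  define L where "L = real_of_int \<bar>lead_coeff f\<bar>"
  define R where "R = (\<Prod>z\<leftarrow>zs. cmod z)"
  \<comment> \<open>With the sign of the root as evaluation point, its factor is exactly |t| -
    1.\<close>
  define s :: int where "s = (if t > 0 then 1 else -1)"
  have L: "0 \<le> L" by (simp add: L_def)
  have zs: "1 \<le> cmod z" if "z \<in> set zs" for z using root_norm[of z] that rs by simp
  have R: "1 \<le> R" unfolding R_def using zs by (intro prod_list_ge_one) auto
  have "poly F (of_int s) \<noteq> 0"
    using expansive unfolding expansive_def by (auto simp: s_def)
  hence "1 \<le> cmod (poly F (of_int s))"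
    unfolding poly_map_poly_of_int by (intro norm_of_int_ge_one)
  also have "\<dots> = L * (cmod (of_int s - \<alpha>) * (\<Prod>z\<leftarrow>zs. cmod (of_int s - z)))"
    by (simp only: norm_poly rs L_def list.map prod_list.Cons)
  also have "cmod (of_int s - \<alpha>) = \<bar>t\<bar> - 1"
  proof -
    have "of_int s - \<alpha> = of_real (of_int s - t)" by (simp add: t)
    hence "cmod (of_int s - \<alpha>) = \<bar>of_int s - t\<bar>" by (simp only: norm_of_real)
    thus ?thesis using t1 by (auto simp: s_def)
  qed
  also have "L * ((\<bar>t\<bar> - 1) * (\<Prod>z\<leftarrow>zs. cmod (of_int s - z)))
      \<le> L * ((\<bar>t\<bar> - 1) * (\<Prod>z\<leftarrow>zs. 1 + cmod z))"
  proof -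
    have "cmod (of_int s - z) \<le> 1 + cmod z" for z
      using norm_triangle_ineq4[of "of_int s" z] by (auto simp: s_def split: if_splits)
    thus ?thesis using t1 L prod_list_nonneg_mono[of zs "\<lambda>z. cmod (of_int s - z)"]
      by (intro mult_left_mono) auto
  qed
  finally have "1 / (\<bar>t\<bar> - 1) \<le> L * (\<Prod>z\<leftarrow>zs. 1 + cmod z)"
    using t1 by (simp add: field_simps)
  also have "\<dots> \<le> L * (2 ^ length zs / 2 * (1 + R))"
  proof -
    have "1 \<le> x" if "x \<in> set (map cmod zs)" for x using that zs by auto
    from prod_list_one_plus_le[of "map cmod zs", OF this] have "2 * (\<Prod>z\<leftarrow>zs. 1 + cmod z) \<le> 2 ^ length zs * (1 + R)"
      by (simp add: R_def o_def)
    thus ?thesis using L by (intro mult_left_mono) auto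
  qed
  also have "\<dots> = 2 ^ length zs / 2 * (L + L * R)" by (simp add: algebra_simps)
  \<comment> \<open>\<open>R\<close> omits the root itself; inserting |t| > 1 completes the product
    to |a_0|.\<close>
  also have "\<dots> \<le> 2 ^ length zs / 2 * (L + L * (\<bar>t\<bar> * R))"
    using t1 R L by (intro mult_left_mono add_left_mono) (auto simp: mult_le_cancel_right1)
  also have "L * (\<bar>t\<bar> * R) = \<bar>coeff f 0\<bar>"
    using norm_coeff_0 by (simp add: rs t L_def R_def)
  also have "2 ^ length zs / 2 = (2::real) powi (int (degree f) - 2)"
    using length_rs by (simp add: rs power_int_diff flip: power_Suc)
  finally show ?thesis by (simp add: t L_def add.commute)
qed

text \<open>The conjugate pair is kept apart from the estimate of the other factors: it contributes
  r^2 - 1 to the integer and 1 + r^2 to the majorant.\<close>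

lemma nonreal_root_bound:
  assumes rs: "rs = \<alpha> # cnj \<alpha> # zs"
  defines "n \<equiv> degree f"
  shows "1 / (cmod \<alpha> - 1)
    \<le> 2 ^ ((n - 1) choose 2) * (\<bar>coeff f 0\<bar> + \<bar>lead_coeff f\<bar>) ^ (n - 1) + 1"
proof -
  define L where "L = real_of_int \<bar>lead_coeff f\<bar>"
  define R where "R = (\<Prod>r\<leftarrow>rs. cmod r)"
  define r where "r = cmod \<alpha>"
  define g :: "complex \<Rightarrow> complex \<Rightarrow> real" where "g x y = cmod (1 - x * y)" for x y
  define h :: "complex \<Rightarrow> complex \<Rightarrow> real" where "h x y = 1 + cmod x * cmod y" for x y
  define G where "G = (\<Prod>z\<leftarrow>zs. g \<alpha> z) * pair_prod g (cnj \<alpha> # zs)"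
  define H where "H = (\<Prod>z\<leftarrow>zs. h \<alpha> z) * pair_prod h (cnj \<alpha> # zs)"
  define B where "B = 2 ^ ((n - 1) choose 2) * (L * (1 + R)) ^ (n - 1)"
  have n: "length rs = n" by (simp add: n_def length_rs)
  have L: "0 \<le> L" by (simp add: L_def)
  have r: "1 < r" using root_norm rs by (simp add: r_def)
  hence r2: "1 < r^2" by (simp add: power2_eq_square less_1_mult)
  have g: "pair_prod g rs = (r^2 - 1) * G"
  proof -
    have "1 - \<alpha> * cnj \<alpha> = of_real (1 - r^2)"
      by (simp add: r_def complex_norm_square del: of_real_power)
    hence "g \<alpha> (cnj \<alpha>) = \<bar>1 - r^2\<bar>" by (simp only: g_def norm_of_real)
    thus ?thesis using r2 by (simp add: rs G_def)
  qed
  have h: "pair_prod h rs = (1 + r^2) * H"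
  proof -
    have "h \<alpha> (cnj \<alpha>) = 1 + r^2" by (simp add: h_def r_def power2_eq_square)
    thus ?thesis by (simp add: rs H_def)
  qed
  have gh: "0 \<le> g x y \<and> g x y \<le> h x y" for x y
    using norm_triangle_ineq4[of 1 "x * y"] by (simp add: g_def h_def norm_mult)
  have GH: "G \<le> H"
    unfolding G_def H_def
    using prod_list_nonneg_mono[of zs "g \<alpha>" "h \<alpha>"] pair_prod_nonneg_mono[of g h "cnj \<alpha> # zs"] gh
    by (intro mult_mono) auto
  have "1 \<le> L ^ (n - 1) * pair_prod g rs"
  proof -
    define J where "J = det (jury_mat (n - 1) f)"
    have roots: "x \<noteq> 0 \<and> x^2 \<noteq> 1" if "x \<in> set rs" for x
      using root_norm[OF that] by (auto simp: power2_eq_1_iff)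
    have "jury_mat (n - 1) F = map_mat of_int (jury_mat (n - 1) f)"
      by (rule eq_matI) (auto simp: jury_mat_def coeff_int_def coeff_map_poly)
    hence "complex_of_int J = det (jury_mat (n - 1) F)"
      unfolding J_def by (simp add: of_int_hom.hom_det)
    also have "\<dots> = (-1) ^ (n choose 2) * of_int (lead_coeff f) ^ (n - 1)
        * pair_prod (\<lambda>x y. 1 - x * y) rs"
      unfolding factors n[symmetric]
      by (rule det_jury_mat_roots[OF _ roots]) (simp_all add: rs)
    finally have J: "cmod (of_int J) = L ^ (n - 1) * pair_prod g rs"
      by (simp add: norm_mult norm_power norm_pair_prod L_def g_def[abs_def])
    \<comment> \<open>Any two roots satisfy |x y| > 1, so x y = 1 is impossible.\<close>
    have "pair_prod g rs \<noteq> 0"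
    proof -
      have "g x y \<noteq> 0" if "x \<in> set rs" "y \<in> set rs" for x y
        using root_norm[OF that(1)] root_norm[OF that(2)] less_1_mult[of "cmod x" "cmod y"]
        by (auto simp: g_def norm_mult dest!: arg_cong[of _ _ cmod])
      hence "pair_prod g xs \<noteq> 0" if "set xs \<subseteq> set rs" for xs
        using that by (induction xs) (fastforce simp: prod_list_zero_iff)+
      from this[of rs] show ?thesis by simp
    qed
    moreover have "L \<noteq> 0" using nonzero by (simp add: L_def)
    ultimately have "of_int J \<noteq> (0::complex)" using J by auto
    thus ?thesis using norm_of_int_ge_one J by metis
  qed
  also have "\<dots> = (r^2 - 1) * (L ^ (n - 1) * G)" by (simp add: g)
  also have "\<dots> \<le> (r^2 - 1) * (L ^ (n - 1) * H)"
    using r2 L GH by (intro mult_left_mono) auto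
  \<comment> \<open>Multiplying by 1 + r^2 restores the factor missing from \<open>H\<close>, so
    that the bound for the full pair product applies.\<close>
  finally have "(1 + r^2) * 1 \<le> (1 + r^2) * ((r^2 - 1) * (L ^ (n - 1) * H))"
    using r2 by (intro mult_left_mono) auto
  hence "r^2 + 1 \<le> (r^2 - 1) * (L ^ (n - 1) * pair_prod h rs)"
    by (simp add: h ac_simps)
  also have "\<dots> \<le> (r^2 - 1) * B"
  proof -
    have "pair_prod h rs \<le> 2 ^ ((n - 1) choose 2) * (1 + R) ^ (n - 1)"
    proof -
      have "1 \<le> x" if "x \<in> set (map cmod rs)" for x using that root_norm by fastforce
      moreover have "map cmod rs \<noteq> []" by (simp add: rs)
      ultimately show ?thesis
        using pair_prod_one_plus_le[of "map cmod rs"] n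
        by (simp add: pair_prod_map h_def[abs_def] R_def)
    qed
    hence "L ^ (n - 1) * pair_prod h rs \<le> L ^ (n - 1) * (2 ^ ((n - 1) choose 2) * (1 + R) ^ (n - 1))"
      using L by (intro mult_left_mono) auto
    thus ?thesis using r2 by (intro mult_left_mono) (auto simp: B_def power_mult_distrib ac_simps)
  qed
  finally have "r^2 + 1 \<le> (r^2 - 1) * B" .
  \<comment> \<open>Adding r^2 - 1 to both sides of the previous inequality gives 2 r^2 on the left
    and B + 1 as cofactor on the right; then r + 1 cancels from r^2 - 1.\<close>
  moreover have "r + 1 \<le> 2 * r^2"
    using r r2 self_le_power[of r 2] by linarith
  ultimately have "r + 1 \<le> (r^2 - 1) * (B + 1)" by (simp add: algebra_simps)
  hence "(r + 1) * 1 \<le> (r + 1) * ((r - 1) * (B + 1))"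
    by (simp add: algebra_simps power2_eq_square)
  hence "1 \<le> (r - 1) * (B + 1)" using r by (subst (asm) mult_le_cancel_left_pos) auto
  hence "1 / (r - 1) \<le> B + 1" using r by (simp add: field_simps)
  moreover have "L * (1 + R) = \<bar>coeff f 0\<bar> + \<bar>lead_coeff f\<bar>"
    using norm_coeff_0 by (simp add: L_def R_def algebra_simps)
  ultimately show ?thesis by (simp add: B_def r_def)
qed

end

section \<open>Choosing the head of the list of roots\<close>

theorem theorem4p4:
  fixes f :: "int poly" and n :: nat and \<alpha> :: complex
  assumes deg: "degree f = n" and n: "1 \<le> n"
    and exp: "expansive (map_poly of_int f)"
    and root: "poly (map_poly of_int f) \<alpha> = 0"
  shows "1 / (cmod \<alpha> - 1) \<le>
    (if \<alpha> \<in> \<real>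
     then 2 powi (int n - 2) * real_of_int (\<bar>coeff f 0\<bar> + \<bar>coeff f n\<bar>)
     else 2 ^ ((n - 1) choose 2) * real_of_int (\<bar>coeff f 0\<bar> + \<bar>coeff f n\<bar>) ^ (n - 1) + 1)"
proof -
  define F where "F = map_poly complex_of_int f"
  have f: "f \<noteq> 0" using deg n by auto
  hence F: "F \<noteq> 0" by (simp add: F_def)
  have lc: "lead_coeff F = of_int (lead_coeff f)"
    by (simp add: F_def degree_map_poly coeff_map_poly)
  have \<alpha>: "\<alpha> \<in># proots F" using root F by (simp add: F_def)
  show ?thesis
  proof (cases "\<alpha> \<in> \<real>")
    case True
    obtain zs where "F = Polynomial.smult (lead_coeff F) (\<Prod>r\<leftarrow>[\<alpha>] @ zs. [:-r, 1:])"
      by (rule complex_poly_roots_extend[of "[\<alpha>]"]) (use \<alpha> in auto)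
    then interpret expansive_int_poly f "\<alpha> # zs"
      using f exp unfolding lc by unfold_locales (simp_all add: F_def)
    show ?thesis using real_root_bound[OF refl True] True deg by simp
  next
    case False
    \<comment> \<open>The coefficients are real, so the conjugate is a root as well; being distinct
      from \<alpha>, it has its own place in the multiset of roots.\<close>
    have "poly F (cnj \<alpha>) = cnj (poly F \<alpha>)"
      unfolding F_def by (rule poly_cnj_real[symmetric]) (simp add: coeff_map_poly)
    hence "cnj \<alpha> \<in># proots F" using root F by (simp add: F_def)
    moreover have "cnj \<alpha> \<noteq> \<alpha>" using False by (simp add: Reals_cnj_iff)
    ultimately have "mset [\<alpha>, cnj \<alpha>] \<subseteq># proots F"
      using \<alpha> by (simp add: insert_subset_eq_iff in_diff_count)
    then obtain zs where "F = Polynomial.smult (lead_coeff F) (\<Prod>r\<leftarrow>[\<alpha>, cnj \<alpha>] @ zs. [:-r, 1:])"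
      by (rule complex_poly_roots_extend)
    then interpret expansive_int_poly f "\<alpha> # cnj \<alpha> # zs"
      using f exp unfolding lc by unfold_locales (simp_all add: F_def)
    show ?thesis using nonreal_root_bound[OF refl] False deg by simp
  qed
qed

end
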